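(* Let $H$ be a topological group acting continuously on a metric space $X$, let $\Lambda$ be a metric space, and let $a,b:\Lambda\to H$ be continuous functions; write $a_\lambda=a(\lambda)$, $b_\lambda=b(\lambda)$ and $H_\lambda=\langle a_\lambda,b_\lambda\rangle$. Let $X_1,X_2\subseteq X$ be disjoint and open, and let $K_i\subseteq X_i$ be nonempty compact subsets for $i=1,2$. Suppose that for some $\lambda_0\in\Lambda$ and every integer $n\neq0$, $a_{\lambda_0}^nX_1\subseteq X_2$ and $b_{\lambda_0}^nX_2\subseteq X_1$. Then for every $N\in\mathbb{N}$ there exists a neighborhood $U\subseteq\Lambda$ of $\lambda_0$ with the following property: for every $\lambda\in U$ and every relator $\overline{w}$ of $H_\lambda$ whose first and last letters are identical (up to inversion), $\overline{w}$ has an exact subword from $\mathcal{F}(W^\lambda_{X\to K})$ whose length is at least $N$. If in addition there exists $M\in\mathbb{N}$ such that $\overline{a}^k\in W^\lambda_{X\to K}$ for every integer $k$ with $|k|\ge M$ and every $\lambda\in\Lambda$, then the assumption on the first and last letters of $\overline{w}$ can be dropped.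
   Context: $F_2$ is the free group generated by the symbols $\overline{a},\overline{b}$. For $\lambda\in\Lambda$ and $\overline{w}\in F_2$, write $w_\lambda=\overline{w}(a_\lambda,b_\lambda)\in H_\lambda$. A relator of $H_\lambda$ is a nonempty reduced word $\overline{w}\in F_2$ with $w_\lambda=1$. The length of a reduced word is its number of letters. If $s_1^{n_1}\cdots s_k^{n_k}$ is a reduced word (with $s_j\in\{\overline{a},\overline{b}\}$, $s_j\ne s_{j+1}$, $n_j\in\mathbb{Z}\setminus\{0\}$), its syllables are the $s_j^{n_j}$, and an exact subword is any nonempty subword composed of consecutive full syllables, i.e. $s_i^{n_i}\cdots s_j^{n_j}$ with $i\le j$. For $W\subseteq F_2$, $\mathcal{F}(W)$ is the set of all nonempty $\overline{w}\in F_2$ such that no exact subword of $\overline{w}$ belongs to $W$. For $x,y\in\{a,b\}$, $F_2^{\overline{x},\overline{y}}$ is the set of nonempty reduced words whose first letter is $\overline{x}^{\pm1}$ and whose last letter is $\overline{y}^{\pm1}$. $W^\lambda_{X\to K}\subseteq F_2$ is the set of all $\overline{w}\in F_2$ such that: $w_\lambda(X_1)\subseteq K_2$ if $\overline{w}\in F_2^{\overline{a},\overline{a}}$; $w_\lambda(X_2)\subseteq K_2$ if $\overline{w}\in F_2^{\overline{a},\overline{b}}$; $w_\lambda(X_1)\subseteq K_1$ if $\overline{w}\in F_2^{\overline{b},\overline{a}}$; $w_\lambda(X_2)\subseteq K_1$ if $\overline{w}\in F_2^{\overline{b},\overline{b}}$. "First and last letters identical (up to inversion)" means the relator lies in $F_2^{\overline{a},\overline{a}}\cup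 F_2^{\overline{b},\overline{b}}$. *)

theory Defs
  imports
    "HOL-Analysis.Analysis"
    "HOL-Algebra.Group_Action"
    "HOL-Library.Sublist"
begin

section \<open>Topological groups and continuous actions\<close>

locale topological_group = group G for G :: "('g, 'm) monoid_scheme" (structure) +
  fixes T :: "'g topology"
  assumes topspace_eq: "topspace T = carrier G"
    and continuous_mult: "continuous_map (prod_topology T T) T (\<lambda>(x, y). x \<otimes> y)"
    and continuous_inv: "continuous_map T T (\<lambda>x. inv x)"

locale continuous_group_action =
  topological_group G T + group_action G "UNIV :: 'x set" \<phi>
  for G :: "('g, 'm) monoid_scheme" (structure)
    and T :: "'g topology"
    and \<phi> :: "'g \<Rightarrow> 'x::topological_space \<Rightarrow> 'x" +
  assumes continuous_action:
    "continuous_map (prod_topology T euclidean) euclidean (\<lambda>(g, x). \<phi> g x)"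


section \<open>Words in the free group on two symbols\<close>

datatype gen = Gen_a | Gen_b

text \<open>An element of the free group is identified with its reduced word, and this word
  \<open>s1^n1 \<dots> sk^nk\<close> is stored as the list \<open>[(s1, n1), \<dots>, (sk, nk)]\<close> of its
  syllables: the exponents are nonzero and
  consecutive symbols differ. The identity is the empty list.\<close>

type_synonym word = "(gen \<times> int) list"

definition F2 :: "word set" where
  "F2 = {w. (\<forall>(s, n) \<in> set w. n \<noteq> 0) \<and> distinct_adj (map fst w)}"

text \<open>The case distinction is needed because \<open>[(s, 0)]\<close> is not a reduced word.\<close>

definition gen_power :: "gen \<Rightarrow> int \<Rightarrow> word" where
  "gen_power s k = (if k = 0 then [] else [(s, k)])"

text \<open>The length counts letters, not syllables.\<close>

definition word_length :: "word \<Rightarrow> nat" where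
  "word_length w = (\<Sum>(s, n) \<leftarrow> w. nat \<bar>n\<bar>)"

text \<open>The nonempty reduced words with first letter \<open>x\<^sup>\<plusminus>\<^sup>1\<close> and last letter \<open>y\<^sup>\<plusminus>\<^sup>1\<close>.\<close>

definition F2_between :: "gen \<Rightarrow> gen \<Rightarrow> word set" where
  "F2_between x y = {w \<in> F2. w \<noteq> [] \<and> fst (hd w) = x \<and> fst (last w) = y}"

text \<open>As words are lists of syllables, exact subwords are the nonempty contiguous sublists.\<close>

definition exact_subword :: "word \<Rightarrow> word \<Rightarrow> bool" where
  "exact_subword u w \<longleftrightarrow> u \<noteq> [] \<and> sublist u w"

definition words_avoiding :: "word set \<Rightarrow> word set" where
  "words_avoiding W = {w \<in> F2. w \<noteq> [] \<and> (\<forall>u. exact_subword u w \<longrightarrow> u \<notin> W)}"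

primrec gen_value :: "'g \<Rightarrow> 'g \<Rightarrow> gen \<Rightarrow> 'g" where
  "gen_value g h Gen_a = g"
| "gen_value g h Gen_b = h"

fun word_eval :: "('g, 'm) monoid_scheme \<Rightarrow> 'g \<Rightarrow> 'g \<Rightarrow> word \<Rightarrow> 'g" where
  "word_eval G g h [] = \<one>\<^bsub>G\<^esub>"
| "word_eval G g h ((s, n) # w) = (gen_value g h s [^]\<^bsub>G\<^esub> n) \<otimes>\<^bsub>G\<^esub> word_eval G g h w"

text \<open>The relators of the subgroup generated by \<open>g\<close> and \<open>h\<close>, with respect to these generators.\<close>

definition relators :: "('g, 'm) monoid_scheme \<Rightarrow> 'g \<Rightarrow> 'g \<Rightarrow> word set" where
  "relators G g h = {w \<in> F2. w \<noteq> [] \<and> word_eval G g h w = \<one>\<^bsub>G\<^esub>}"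

text \<open>The set of words carrying \<open>X\<close> into \<open>K\<close>, for \<open>g\<close> and \<open>h\<close> in place of
  the symbols (the last letter of a word acts first). The empty word belongs to it vacuously.\<close>

definition W_XK ::
  "('g, 'm) monoid_scheme \<Rightarrow> ('g \<Rightarrow> 'x \<Rightarrow> 'x) \<Rightarrow> 'x set \<Rightarrow> 'x set \<Rightarrow> 'x set \<Rightarrow> 'x set
    \<Rightarrow> 'g \<Rightarrow> 'g \<Rightarrow> word set" where
  "W_XK G \<phi> X1 X2 K1 K2 g h = {w \<in> F2.
     (w \<in> F2_between Gen_a Gen_a \<longrightarrow> \<phi> (word_eval G g h w) ` X1 \<subseteq> K2) \<and>
     (w \<in> F2_between Gen_a Gen_b \<longrightarrow> \<phi> (word_eval G g h w) ` X2 \<subseteq> K2) \<and>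
     (w \<in> F2_between Gen_b Gen_a \<longrightarrow> \<phi> (word_eval G g h w) ` X1 \<subseteq> K1) \<and>
     (w \<in> F2_between Gen_b Gen_b \<longrightarrow> \<phi> (word_eval G g h w) ` X2 \<subseteq> K1)}"

end

theory Submission
  imports Defs
begin

text \<open>Near \<open>l0\<close> the ping-pong inclusions are controlled for short words only: by the tube
  lemma and compactness of \<open>K1\<close> and \<open>K2\<close>, each of the finitely many nonempty reduced words of
  length less than \<open>N\<close> still maps \<open>K1\<close> or \<open>K2\<close> (according to its last letter) into \<open>X1\<close> or \<open>X2\<close>
  (according to its first letter) for all \<open>l\<close> in a neighbourhood \<open>U\<close> of \<open>l0\<close>. This is
  \<open>short_words_carry_nearby\<close>.

  Write \<open>W\<close> for the set of words mapping \<open>X\<close> into \<open>K\<close> at such an \<open>l\<close>, and let \<open>w\<close> be a word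
  whose exact subwords avoiding \<open>W\<close> are all shorter than \<open>N\<close>. Then \<open>w\<close> is a product of factors in
  \<open>W\<close>, which map \<open>X\<close> into \<open>K\<close>, separated by words avoiding \<open>W\<close>, which are short and map \<open>K\<close> into
  \<open>X\<close>. Hence \<open>w\<close>, however long, maps \<open>K\<close> into \<open>X\<close> (\<open>carries_if_avoiding_subwords_carry\<close>). If the first
  and last symbols of \<open>w\<close> agree, this means \<open>K1\<close> is mapped into \<open>X2\<close> or \<open>K2\<close> into \<open>X1\<close>, so \<open>w\<close> is
  not the identity; a relator of this form therefore has a long subword avoiding \<open>W\<close>.

  A relator with different first and last symbols becomes one with equal symbols on conjugation
  by a suitable power of the first generator. When all large powers of that generator are in \<open>W\<close>, the power
  can be chosen such that both end syllables of the conjugate are in \<open>W\<close>; a subword avoiding \<open>W\<close>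
  contains neither, so it already occurs in the original relator, and the same \<open>U\<close> serves.\<close>


section \<open>Words\<close>

lemma F2_append_iff:
  "u @ v \<in> F2 \<longleftrightarrow>
     u \<in> F2 \<and> v \<in> F2 \<and> (u \<noteq> [] \<longrightarrow> v \<noteq> [] \<longrightarrow> fst (last u) \<noteq> fst (hd v))"
  by (auto simp: F2_def distinct_adj_append_iff last_map hd_map)

lemma exact_subword_trans:
  "exact_subword u v \<Longrightarrow> sublist v w \<Longrightarrow> exact_subword u w"
  unfolding exact_subword_def by (metis sublist_order.order_trans)

lemma sublist_ConsD:
  assumes "sublist u (x # v)" "x \<notin> set u"
  shows "sublist u v"
  using assms by (cases u) (auto simp: sublist_Cons_right)

lemma sublist_snocD:
  assumes "sublist u (v @ [x])" "x \<notin> set u"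
  shows "sublist u v"
  using sublist_ConsD[of "rev u" x "rev v"] assms
  by (metis rev.simps(2) rev_rev_ident set_rev sublist_rev)

lemma syllable_in_W_notin_set:
  assumes "u \<in> words_avoiding W" "[x] \<in> W"
  shows "x \<notin> set u"
proof
  assume "x \<in> set u"
  then obtain ys zs where "u = ys @ [x] @ zs"
    by (metis append_Cons append_Nil split_list)
  then have "exact_subword [x] u"
    by (simp add: exact_subword_def del: append_Cons)
  with assms show False
    by (auto simp: words_avoiding_def)
qed

text \<open>Every syllable has at least one letter, so a bound on the length bounds both the number of
  syllables and their exponents.\<close>

lemma finite_short_words: "finite {w \<in> F2. word_length w < N}"
proof -
  let ?A = "(UNIV :: gen set) \<times> {- int N..int N}"
  have gens: "(UNIV :: gen set) = {Gen_a, Gen_b}"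
    by (auto intro: gen.exhaust)
  have "set w \<subseteq> ?A \<and> length w \<le> word_length w"
    if "word_length w < N" "\<forall>(s, n) \<in> set w. n \<noteq> 0" for w
    using that
  proof (induction w)
    case Nil
    then show ?case by simp
  next
    case (Cons p w)
    obtain s n where p: "p = (s, n)" by (cases p)
    have len: "word_length (p # w) = nat \<bar>n\<bar> + word_length w"
      by (simp add: word_length_def p)
    have "set w \<subseteq> ?A \<and> length w \<le> word_length w"
      using Cons len by simp
    moreover have "n \<noteq> 0" using Cons.prems p by auto
    ultimately show ?case
      using Cons.prems(1) len p by auto
  qed
  then have "{w \<in> F2. word_length w < N} \<subseteq> {w. set w \<subseteq> ?A \<and> length w \<le> N}"
    by (fastforce simp: F2_def)
  moreover have "finite {w. set w \<subseteq> ?A \<and> length w \<le> N}"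
    by (rule finite_lists_length_le) (simp add: gens)
  ultimately show ?thesis
    by (rule finite_subset)
qed


section \<open>Words as maps between the ping-pong sets\<close>

text \<open>The indices of the source sets \<open>A1\<close>, \<open>A2\<close> and of the target sets \<open>B1\<close>, \<open>B2\<close> are paired with
  the symbols in opposite order, as \<open>a\<close> moves points of index \<open>1\<close> to index \<open>2\<close> and \<open>b\<close> moves them
  back. So the target of one word is the source of the next exactly when the symbols that meet are
  different, that is, when the concatenation is reduced.\<close>

definition carries ::
  "('g, 'm) monoid_scheme \<Rightarrow> ('g \<Rightarrow> 'x \<Rightarrow> 'x) \<Rightarrow> 'g \<Rightarrow> 'g \<Rightarrow> 'x set \<Rightarrow> 'x set \<Rightarrow> 'x set \<Rightarrow> 'x set
    \<Rightarrow> word \<Rightarrow> bool" where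
  "carries G \<phi> g h A1 A2 B1 B2 w \<longleftrightarrow>
     \<phi> (word_eval G g h w) ` gen_value A1 A2 (fst (last w)) \<subseteq> gen_value B2 B1 (fst (hd w))"

lemma W_XK_iff_carries:
  assumes "w \<in> F2" "w \<noteq> []"
  shows "w \<in> W_XK G \<phi> X1 X2 K1 K2 g h \<longleftrightarrow> carries G \<phi> g h X1 X2 K1 K2 w"
  using assms
  by (cases "fst (hd w)"; cases "fst (last w)")
     (auto simp: W_XK_def carries_def F2_between_def)

lemma carries_mono:
  assumes "carries G \<phi> g h A1 A2 B1 B2 w"
    and "A1' \<subseteq> A1" "A2' \<subseteq> A2" "B1 \<subseteq> B1'" "B2 \<subseteq> B2'"
  shows "carries G \<phi> g h A1' A2' B1' B2' w"
  using assms unfolding carries_def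
  by (cases "fst (hd w)"; cases "fst (last w)"; simp; blast)

context group
begin

lemma gen_value_closed:
  "g \<in> carrier G \<Longrightarrow> h \<in> carrier G \<Longrightarrow> gen_value g h s \<in> carrier G"
  by (cases s) auto

lemma word_eval_closed:
  "g \<in> carrier G \<Longrightarrow> h \<in> carrier G \<Longrightarrow> word_eval G g h w \<in> carrier G"
  by (induction w) (auto simp: gen_value_closed)

lemma word_eval_append:
  "g \<in> carrier G \<Longrightarrow> h \<in> carrier G \<Longrightarrow>
     word_eval G g h (u @ v) = word_eval G g h u \<otimes> word_eval G g h v"
  by (induction u) (auto simp: gen_value_closed word_eval_closed m_assoc)

lemma word_eval_gen_power:
  "g \<in> carrier G \<Longrightarrow> h \<in> carrier G \<Longrightarrow>
     word_eval G g h (gen_power s k) = gen_value g h s [^] k"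
  by (simp add: gen_power_def gen_value_closed)

text \<open>The new word is the reduced form of the conjugate \<open>a\<^sup>k w a\<^sup>-\<^sup>k\<close> of the given word \<open>w\<close>.
  As \<open>gen_power\<close> turns the exponent zero into the empty word, this covers words with a
  syllable in \<open>Gen_a\<close> at only one end, whichever it is.\<close>

lemma relator_conjugate:
  assumes gh: "g \<in> carrier G" "h \<in> carrier G"
    and v: "v \<in> F2_between Gen_b Gen_b"
    and rel: "gen_power Gen_a i @ v @ gen_power Gen_a j \<in> relators G g h"
    and nz: "i + k \<noteq> 0" "j - k \<noteq> 0"
  shows "(Gen_a, i + k) # v @ [(Gen_a, j - k)] \<in> relators G g h"
proof -
  let ?v = "word_eval G g h v"
  have cl: "?v \<in> carrier G" using gh by (simp add: word_eval_closed)
  have eq: "g [^] i \<otimes> (?v \<otimes> g [^] j) = \<one>"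
    using rel gh by (simp add: relators_def word_eval_append word_eval_gen_power)
  have "g [^] (i + k) = g [^] k \<otimes> g [^] i"
    using gh int_pow_mult[of g k i] by (simp add: add.commute)
  moreover have "g [^] (j - k) = g [^] j \<otimes> g [^] (- k)"
    using gh int_pow_mult[of g j "- k"] by simp
  ultimately have "g [^] (i + k) \<otimes> (?v \<otimes> g [^] (j - k))
      = g [^] k \<otimes> (g [^] i \<otimes> (?v \<otimes> g [^] j)) \<otimes> g [^] (- k)"
    using gh cl by (simp add: m_assoc)
  also have "\<dots> = \<one>"
    using eq gh by (simp add: int_pow_neg)
  finally have "word_eval G g h ((Gen_a, i + k) # v @ [(Gen_a, j - k)]) = \<one>"
    using gh by (simp add: word_eval_append)
  moreover have "[(Gen_a, i + k)] @ v @ [(Gen_a, j - k)] \<in> F2"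
    using v nz unfolding F2_append_iff by (auto simp: F2_between_def F2_def)
  ultimately show ?thesis
    by (simp add: relators_def)
qed

end

context continuous_group_action
begin

lemma carries_append:
  assumes gh: "g \<in> carrier G" "h \<in> carrier G"
    and red: "u @ v \<in> F2" and ne: "u \<noteq> []" "v \<noteq> []"
    and v: "carries G \<phi> g h A1 A2 B1 B2 v" and u: "carries G \<phi> g h B1 B2 C1 C2 u"
  shows "carries G \<phi> g h A1 A2 C1 C2 (u @ v)"
proof -
  have "fst (last u) \<noteq> fst (hd v)"
    using red ne by (simp add: F2_append_iff)
  then have mid: "gen_value B2 B1 (fst (hd v)) = gen_value B1 B2 (fst (last u))"
    by (cases "fst (hd v)"; cases "fst (last u)") auto
  have "\<phi> (word_eval G g h (u @ v)) x = \<phi> (word_eval G g h u) (\<phi> (word_eval G g h v) x)" for x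
    using gh by (simp add: word_eval_append word_eval_closed composition_rule)
  then show ?thesis
    using u v ne mid unfolding carries_def by fastforce
qed

lemma ping_pong:
  assumes gh: "g \<in> carrier G" "h \<in> carrier G"
    and a: "\<And>n::int. n \<noteq> 0 \<Longrightarrow> \<phi> (g [^] n) ` X1 \<subseteq> X2"
    and b: "\<And>n::int. n \<noteq> 0 \<Longrightarrow> \<phi> (h [^] n) ` X2 \<subseteq> X1"
    and "w \<in> F2" "w \<noteq> []"
  shows "carries G \<phi> g h X1 X2 X1 X2 w"
  using assms(5,6)
proof (induction w)
  case Nil
  then show ?case by simp
next
  case (Cons p w)
  obtain s n where p: "p = (s, n)" by (cases p)
  have "n \<noteq> 0" using Cons.prems p by (simp add: F2_def)
  then have syl: "carries G \<phi> g h X1 X2 X1 X2 [p]"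
    using a[of n] b[of n] gh by (cases s) (auto simp: carries_def p)
  show ?case
  proof (cases "w = []")
    case True
    with syl show ?thesis by simp
  next
    case False
    have "[p] @ w \<in> F2" using Cons.prems by simp
    then have "carries G \<phi> g h X1 X2 X1 X2 w"
      using Cons.IH False unfolding F2_append_iff by blast
    from carries_append[OF gh \<open>[p] @ w \<in> F2\<close> _ False this syl] show ?thesis
      by simp
  qed
qed

text \<open>A factor in \<open>W\<close> maps \<open>X\<close> into the smaller \<open>K\<close> and so makes up for a factor avoiding \<open>W\<close>,
  which is only known to map \<open>K\<close> into \<open>X\<close>. The induction removes one factor in \<open>W\<close> at a time: on
  \<open>p @ v @ s\<close> with \<open>v\<close> in \<open>W\<close>, read from the right as the action does, the passage is
  \<open>K \<rightarrow> X \<rightarrow> K \<rightarrow> X\<close>, where the outer two steps are induction hypotheses for \<open>s\<close> and \<open>p\<close>.\<close>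

lemma carries_if_avoiding_subwords_carry:
  assumes gh: "g \<in> carrier G" "h \<in> carrier G"
    and K: "K1 \<subseteq> X1" "K2 \<subseteq> X2"
    and "w \<in> F2" "w \<noteq> []"
    and "\<And>u. exact_subword u w \<Longrightarrow> u \<in> words_avoiding (W_XK G \<phi> X1 X2 K1 K2 g h) \<Longrightarrow>
           carries G \<phi> g h K1 K2 X1 X2 u"
  shows "carries G \<phi> g h K1 K2 X1 X2 w"
  using assms(5-)
proof (induction w rule: length_induct)
  case (1 w)
  let ?W = "W_XK G \<phi> X1 X2 K1 K2 g h"
  have IH: "carries G \<phi> g h K1 K2 X1 X2 u"
    if "exact_subword u w" "length u < length w" "u \<in> F2" for u
    using that 1 exact_subword_trans unfolding exact_subword_def by blast
  show ?case
  proof (cases "w \<in> words_avoiding ?W")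
    case True
    then show ?thesis using 1 by (simp add: exact_subword_def)
  next
    case False
    then obtain v where v: "exact_subword v w" "v \<in> ?W"
      using 1 by (auto simp: words_avoiding_def)
    then obtain p s where w: "w = p @ v @ s" and "v \<noteq> []"
      by (auto simp: exact_subword_def sublist_def)
    have sub: "sublist p w" "sublist s w"
      using sublist_append_leftI[of s "p @ v"] by (simp_all add: w)
    have F2: "p \<in> F2" "v \<in> F2" "s \<in> F2" "v @ s \<in> F2"
      using 1(2) unfolding w F2_append_iff by auto
    have vXK: "carries G \<phi> g h X1 X2 K1 K2 v"
      using v(2) F2(2) \<open>v \<noteq> []\<close> by (simp add: W_XK_iff_carries)
    have vs: "carries G \<phi> g h K1 K2 K1 K2 (v @ s)"
    proof (cases "s = []")
      case True
      then show ?thesis using carries_mono[OF vXK K] by simp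
    next
      case False
      have "carries G \<phi> g h K1 K2 X1 X2 s"
        using False F2 \<open>v \<noteq> []\<close> w sub by (intro IH) (auto simp: exact_subword_def)
      from carries_append[OF gh F2(4) \<open>v \<noteq> []\<close> False this vXK] show ?thesis .
    qed
    show ?thesis
    proof (cases "p = []")
      case True
      then show ?thesis using carries_mono[OF vs _ _ K] w by simp
    next
      case False
      have "carries G \<phi> g h K1 K2 X1 X2 p"
        using False F2 \<open>v \<noteq> []\<close> w sub by (intro IH) (auto simp: exact_subword_def)
      from carries_append[OF gh _ False _ vs this] show ?thesis
        using 1(2) w \<open>v \<noteq> []\<close> by simp
    qed
  qed
qed

text \<open>A relator acts as the identity, but if its first and last symbols agree, its source and
  target are disjoint.\<close>

lemma relator_not_carries:
  assumes w: "w \<in> relators G g h" "w \<in> F2_between Gen_a Gen_a \<union> F2_between Gen_b Gen_b"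
    and K: "K1 \<subseteq> X1" "K1 \<noteq> {}" "K2 \<subseteq> X2" "K2 \<noteq> {}" and dis: "X1 \<inter> X2 = {}"
  shows "\<not> carries G \<phi> g h K1 K2 X1 X2 w"
proof -
  have "\<phi> (word_eval G g h w) = (\<lambda>x. x)"
    using w(1) id_eq_one by (simp add: relators_def restrict_def)
  moreover have "\<not> K1 \<subseteq> X2" "\<not> K2 \<subseteq> X1"
    using K dis by blast+
  ultimately show ?thesis
    using w(2) by (auto simp: carries_def F2_between_def)
qed


section \<open>Stability under perturbation of the generators\<close>

lemma continuous_map_in_carrier: "continuous_map euclidean T f \<Longrightarrow> f y \<in> carrier G"
  by (auto simp: continuous_map_def Pi_iff topspace_eq)

lemma continuous_map_int_pow:
  assumes f: "continuous_map Y T f"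
  shows "continuous_map Y T (\<lambda>y. f y [^] (n::int))"
proof -
  have mult: "continuous_map Y T (\<lambda>y. p y \<otimes> q y)"
    if "continuous_map Y T p" "continuous_map Y T q" for p q
    using continuous_map_compose[OF continuous_map_pairedI[OF that] continuous_mult]
    by (simp add: o_def)
  have nat: "continuous_map Y T (\<lambda>y. f y [^] (k::nat))" for k
  proof (induction k)
    case 0
    then show ?case by (simp add: topspace_eq)
  next
    case (Suc k)
    then show ?case using mult f by simp
  qed
  have "continuous_map Y T (\<lambda>y. inv (f y [^] k))" for k :: nat
    using continuous_map_compose[OF nat continuous_inv, of k] by (simp add: o_def)
  with nat show ?thesis
    unfolding int_pow_def2 by (cases "n < 0") (simp_all only: if_True if_False)
qed

lemma continuous_map_word_eval:
  assumes a: "continuous_map Y T a" and b: "continuous_map Y T b"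
  shows "continuous_map Y T (\<lambda>y. word_eval G (a y) (b y) w)"
proof (induction w)
  case Nil
  then show ?case by (simp add: topspace_eq)
next
  case (Cons p w)
  obtain s n where p: "p = (s, n)" by (cases p)
  have "continuous_map Y T (\<lambda>y. gen_value (a y) (b y) s)"
    using a b by (cases s) auto
  then have "continuous_map Y T (\<lambda>y. gen_value (a y) (b y) s [^] n)"
    by (rule continuous_map_int_pow)
  from continuous_map_compose[OF continuous_map_pairedI[OF this Cons.IH] continuous_mult]
  show ?case by (simp add: o_def p)
qed

text \<open>The parameters \<open>l\<close> and points \<open>x\<close> for which the word moves \<open>x\<close> into the open target form an
  open set. It contains \<open>l0\<close> together with the whole compact source, hence a tube around it.\<close>

lemma carries_stable:
  fixes a b :: "'l::topological_space \<Rightarrow> 'g"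
  assumes a: "continuous_map euclidean T a" and b: "continuous_map euclidean T b"
    and K: "compact K1" "compact K2" and X: "open X1" "open X2"
    and w: "carries G \<phi> (a l0) (b l0) K1 K2 X1 X2 w"
  shows "\<exists>U. open U \<and> l0 \<in> U \<and> (\<forall>l\<in>U. carries G \<phi> (a l) (b l) K1 K2 X1 X2 w)"
proof -
  let ?K = "gen_value K1 K2 (fst (last w))" and ?X = "gen_value X2 X1 (fst (hd w))"
  let ?f = "\<lambda>(l, x). \<phi> (word_eval G (a l) (b l) w) x"
  have "compact ?K" "open ?X"
    using K X by (cases "fst (last w)"; simp) (cases "fst (hd w)"; use X in simp)
  have "continuous_map euclidean T (\<lambda>z. word_eval G (a (fst z)) (b (fst z)) w)"
    using continuous_map_compose[of euclidean euclidean fst, OF _ continuous_map_word_eval[OF a b, of w]]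
    by (simp add: o_def continuous_on_fst)
  moreover have "continuous_map euclidean euclidean (snd :: 'l \<times> 'x \<Rightarrow> 'x)"
    by (simp add: continuous_on_snd)
  ultimately have "continuous_map euclidean euclidean ?f"
    using continuous_map_compose[OF continuous_map_pairedI continuous_action]
    by (fastforce simp: o_def case_prod_unfold)
  then have "continuous_on UNIV ?f" by simp
  then have "open (?f -` ?X)"
    using \<open>open ?X\<close> by (rule open_vimage[rotated])
  moreover have "{l0} \<times> ?K \<subseteq> ?f -` ?X"
    using w by (auto simp: carries_def)
  ultimately obtain U where "open U" "l0 \<in> U" "U \<times> ?K \<subseteq> ?f -` ?X"
    using Elementary_Topology.tube_lemma[OF \<open>compact ?K\<close>, of "?f -` ?X" l0] by blast
  then show ?thesis
    unfolding carries_def by (intro exI[of _ U]) auto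
qed

text \<open>At \<open>l0\<close> every nonempty reduced word maps \<open>X\<close> into \<open>X\<close>, in particular \<open>K\<close> into \<open>X\<close>, which is the
  form that persists nearby. The neighbourhood depends on the word, and the bound on the length
  leaves only finitely many of them to intersect.\<close>

lemma short_words_carry_nearby:
  fixes a b :: "'l::topological_space \<Rightarrow> 'g"
  assumes a: "continuous_map euclidean T a" and b: "continuous_map euclidean T b"
    and K: "compact K1" "compact K2" "K1 \<subseteq> X1" "K2 \<subseteq> X2" and X: "open X1" "open X2"
    and pa: "\<And>n::int. n \<noteq> 0 \<Longrightarrow> \<phi> (a l0 [^] n) ` X1 \<subseteq> X2"
    and pb: "\<And>n::int. n \<noteq> 0 \<Longrightarrow> \<phi> (b l0 [^] n) ` X2 \<subseteq> X1"
  shows "\<exists>U. open U \<and> l0 \<in> U \<and>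
           (\<forall>l\<in>U. \<forall>w\<in>F2. w \<noteq> [] \<longrightarrow> word_length w < N \<longrightarrow>
              carries G \<phi> (a l) (b l) K1 K2 X1 X2 w)"
proof -
  let ?S = "{w \<in> F2. word_length w < N} - {[]}"
  have gh: "a l0 \<in> carrier G" "b l0 \<in> carrier G"
    using a b by (simp_all add: continuous_map_in_carrier)
  have "\<exists>U. open U \<and> l0 \<in> U \<and> (\<forall>l\<in>U. carries G \<phi> (a l) (b l) K1 K2 X1 X2 w)"
    if "w \<in> ?S" for w
  proof (rule carries_stable[OF a b K(1,2) X])
    have "carries G \<phi> (a l0) (b l0) X1 X2 X1 X2 w"
      using that ping_pong[OF gh pa pb, of w] by simp
    then show "carries G \<phi> (a l0) (b l0) K1 K2 X1 X2 w"
      using K(3,4) by (rule carries_mono) simp_all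
  qed
  then have "\<forall>w\<in>?S. \<exists>U. open U \<and> l0 \<in> U \<and> (\<forall>l\<in>U. carries G \<phi> (a l) (b l) K1 K2 X1 X2 w)"
    by (rule ballI)
  then obtain U where U:
    "\<forall>w\<in>?S. open (U w) \<and> l0 \<in> U w \<and> (\<forall>l\<in>U w. carries G \<phi> (a l) (b l) K1 K2 X1 X2 w)"
    by (rule bchoice[THEN exE])
  have "open (\<Inter>w\<in>?S. U w)"
    using U finite_short_words by (intro open_INT finite_Diff) blast+
  moreover have "l0 \<in> (\<Inter>w\<in>?S. U w)"
    using U by blast
  moreover have "carries G \<phi> (a l) (b l) K1 K2 X1 X2 w"
    if "l \<in> (\<Inter>w\<in>?S. U w)" "w \<in> F2" "w \<noteq> []" "word_length w < N" for l w
    using U that by blast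
  ultimately show ?thesis
    by blast
qed

end


section \<open>Long avoiding subwords of relators\<close>

text \<open>A relator and its conjugate by a power of \<open>Gen_a\<close> share the middle part \<open>v\<close>. A subword of the
  conjugate that avoids \<open>W\<close> cannot touch end syllables in \<open>W\<close>, so it lies in \<open>v\<close>.\<close>

lemma avoiding_subword_transfer:
  assumes u: "exact_subword u (x # v @ [y])" "u \<in> words_avoiding W"
    and xy: "[x] \<in> W" "[y] \<in> W"
  shows "exact_subword u (p @ v @ q)"
proof -
  have "sublist u (x # v @ [y])" "u \<noteq> []"
    using u(1) by (simp_all add: exact_subword_def)
  from sublist_ConsD[OF this(1) syllable_in_W_notin_set[OF u(2) xy(1)]]
  have "sublist u v"
    by (rule sublist_snocD[OF _ syllable_in_W_notin_set[OF u(2) xy(2)]])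
  with \<open>u \<noteq> []\<close> show ?thesis
    using exact_subword_trans[of u v "p @ v @ q"] by (simp add: exact_subword_def)
qed

lemma word_with_different_end_symbols:
  assumes "w \<in> F2" "w \<noteq> []" "w \<notin> F2_between Gen_a Gen_a \<union> F2_between Gen_b Gen_b"
  obtains i j v where "w = gen_power Gen_a i @ v @ gen_power Gen_a j" "v \<in> F2_between Gen_b Gen_b"
proof (cases "fst (hd w)")
  case Gen_a
  then obtain n v where w: "w = [(Gen_a, n)] @ v"
    using assms(2) by (cases w) auto
  have F: "v \<in> F2" "n \<noteq> 0"
    using assms(1) unfolding w F2_append_iff by (auto simp: F2_def)
  have b: "fst (last w) = Gen_b"
    using assms Gen_a by (cases "fst (last w)") (auto simp: F2_between_def)
  then have "v \<noteq> []" using w by auto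
  then have "fst (hd v) \<noteq> Gen_a"
    using assms(1) unfolding w F2_append_iff by auto
  then have "v \<in> F2_between Gen_b Gen_b"
    using F b \<open>v \<noteq> []\<close> w by (cases "fst (hd v)") (auto simp: F2_between_def)
  then show ?thesis
    using that[of n v 0] w F by (simp add: gen_power_def)
next
  case Gen_b
  then have a: "fst (last w) = Gen_a"
    using assms by (cases "fst (last w)") (auto simp: F2_between_def)
  then obtain n v where w: "w = v @ [(Gen_a, n)]"
    using assms(2) by (cases w rule: rev_cases) auto
  have F: "v \<in> F2" "n \<noteq> 0"
    using assms(1) unfolding w F2_append_iff by (auto simp: F2_def)
  have "v \<noteq> []" using w Gen_b by auto
  then have "fst (last v) \<noteq> Gen_a"
    using assms(1) unfolding w F2_append_iff by auto
  then have "v \<in> F2_between Gen_b Gen_b"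
    using F Gen_b \<open>v \<noteq> []\<close> w by (cases "fst (last v)") (auto simp: F2_between_def)
  then show ?thesis
    using that[of 0 v n] w F by (simp add: gen_power_def)
qed

theorem proposition2p8:
  fixes H :: "('h, 'm) monoid_scheme"
    and T :: "'h topology"
    and \<phi> :: "'h \<Rightarrow> 'x::metric_space \<Rightarrow> 'x"
    and a b :: "'l::metric_space \<Rightarrow> 'h"
    and X1 X2 K1 K2 :: "'x set"
    and l0 :: 'l
  assumes "continuous_group_action H T \<phi>"
    and "continuous_map euclidean T a" and "continuous_map euclidean T b"
    and "open X1" and "open X2" and "X1 \<inter> X2 = {}"
    and "compact K1" and "K1 \<noteq> {}" and "K1 \<subseteq> X1"
    and "compact K2" and "K2 \<noteq> {}" and "K2 \<subseteq> X2"
    and "\<And>n::int. n \<noteq> 0 \<Longrightarrow> \<phi> (a l0 [^]\<^bsub>H\<^esub> n) ` X1 \<subseteq> X2"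
    and "\<And>n::int. n \<noteq> 0 \<Longrightarrow> \<phi> (b l0 [^]\<^bsub>H\<^esub> n) ` X2 \<subseteq> X1"
  shows "(\<forall>N::nat. \<exists>U. l0 \<in> interior U \<and>
            (\<forall>l\<in>U. \<forall>w \<in> relators H (a l) (b l) \<inter>
                           (F2_between Gen_a Gen_a \<union> F2_between Gen_b Gen_b).
               \<exists>u. exact_subword u w \<and>
                   u \<in> words_avoiding (W_XK H \<phi> X1 X2 K1 K2 (a l) (b l)) \<and>
                   N \<le> word_length u))
       \<and> ((\<exists>M::nat. \<forall>k::int. \<forall>l. int M \<le> \<bar>k\<bar> \<longrightarrow>
               gen_power Gen_a k \<in> W_XK H \<phi> X1 X2 K1 K2 (a l) (b l))
          \<longrightarrow> (\<forall>N::nat. \<exists>U. l0 \<in> interior U \<and>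
                (\<forall>l\<in>U. \<forall>w \<in> relators H (a l) (b l).
                   \<exists>u. exact_subword u w \<and>
                       u \<in> words_avoiding (W_XK H \<phi> X1 X2 K1 K2 (a l) (b l)) \<and>
                       N \<le> word_length u)))"
proof -
  interpret continuous_group_action H T \<phi> by fact
  have gh: "a l \<in> carrier H" "b l \<in> carrier H" for l
    using assms(2,3) by (simp_all add: continuous_map_in_carrier)
  let ?W = "\<lambda>l. W_XK H \<phi> X1 X2 K1 K2 (a l) (b l)"
  let ?good = "\<lambda>N l w. \<exists>u. exact_subword u w \<and> u \<in> words_avoiding (?W l) \<and> N \<le> word_length u"
  let ?same = "F2_between Gen_a Gen_a \<union> F2_between Gen_b Gen_b"
  have same: "\<exists>U. l0 \<in> interior U \<and> (\<forall>l\<in>U. \<forall>w \<in> relators H (a l) (b l) \<inter> ?same. ?good N l w)"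
    for N
  proof -
    obtain U where U: "open U" "l0 \<in> U"
      and carry: "\<And>l w. l \<in> U \<Longrightarrow> w \<in> F2 \<Longrightarrow> w \<noteq> [] \<Longrightarrow> word_length w < N \<Longrightarrow>
        carries H \<phi> (a l) (b l) K1 K2 X1 X2 w"
      using short_words_carry_nearby[OF assms(2,3,7,10,9,12,4,5,13,14), of N] by blast
    have "?good N l w" if l: "l \<in> U" and rel: "w \<in> relators H (a l) (b l)" and w: "w \<in> ?same" for l w
    proof (rule ccontr)
      assume not_good: "\<not> ?good N l w"
      have F2: "w \<in> F2" "w \<noteq> []" using rel by (simp_all add: relators_def)
      have "carries H \<phi> (a l) (b l) K1 K2 X1 X2 u"
        if u: "exact_subword u w" "u \<in> words_avoiding (?W l)" for u
      proof (rule carry[OF l])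
        show "u \<in> F2" "u \<noteq> []" using u(2) by (simp_all add: words_avoiding_def)
        show "word_length u < N" using u not_good not_le by blast
      qed
      then have "carries H \<phi> (a l) (b l) K1 K2 X1 X2 w"
        by (rule carries_if_avoiding_subwords_carry[OF gh assms(9,12) F2])
      then show False
        using relator_not_carries[OF rel w assms(9,8,12,11,6)] by (rule notE[rotated])
    qed
    moreover have "l0 \<in> interior U"
      using U by (simp add: interior_open)
    ultimately show ?thesis by blast
  qed
  have any: "?good N l w"
    if M: "\<And>k. int M \<le> \<bar>k\<bar> \<Longrightarrow> gen_power Gen_a k \<in> ?W l"
      and good: "\<And>w. w \<in> relators H (a l) (b l) \<inter> ?same \<Longrightarrow> ?good N l w"
      and w: "w \<in> relators H (a l) (b l)"
    for M N :: nat and l w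
  proof (cases "w \<in> ?same")
    case True
    then show ?thesis using good w by blast
  next
    case False
    have "w \<in> F2" "w \<noteq> []" using w by (simp_all add: relators_def)
    from this False obtain i j v where ijv: "w = gen_power Gen_a i @ v @ gen_power Gen_a j"
      and v: "v \<in> F2_between Gen_b Gen_b"
      by (rule word_with_different_end_symbols)
    \<comment> \<open>Any \<open>k\<close> with \<open>i + k \<ge> max M 1\<close> and \<open>j - k \<le> - max M 1\<close> would do: both end exponents of
      the conjugate must be nonzero and at least \<open>M\<close> in absolute value.\<close>
    define k where "k = int M + \<bar>i\<bar> + \<bar>j\<bar> + 1"
    have k: "i + k \<noteq> 0" "j - k \<noteq> 0" "int M \<le> \<bar>i + k\<bar>" "int M \<le> \<bar>j - k\<bar>"
      by (auto simp: k_def)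
    let ?w = "(Gen_a, i + k) # v @ [(Gen_a, j - k)]"
    have "?w \<in> relators H (a l) (b l)"
      using relator_conjugate[OF gh v _ k(1,2)] w ijv by blast
    moreover from this have "?w \<in> ?same"
      by (simp add: relators_def F2_between_def)
    ultimately obtain u where u: "exact_subword u ?w" "u \<in> words_avoiding (?W l)" "N \<le> word_length u"
      using good by blast
    have "[(Gen_a, i + k)] \<in> ?W l" "[(Gen_a, j - k)] \<in> ?W l"
      using M[OF k(3)] M[OF k(4)] k(1,2) by (simp_all add: gen_power_def)
    then show ?thesis
      using avoiding_subword_transfer[OF u(1,2)] u ijv by blast
  qed
  show ?thesis
  proof (intro conjI impI allI)
    fix N
    assume "\<exists>M::nat. \<forall>k::int. \<forall>l. int M \<le> \<bar>k\<bar> \<longrightarrow> gen_power Gen_a k \<in> ?W l"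
    then obtain M :: nat where M: "\<And>k l. int M \<le> \<bar>k\<bar> \<Longrightarrow> gen_power Gen_a k \<in> ?W l" by blast
    obtain U where U: "l0 \<in> interior U"
      and good: "\<forall>l\<in>U. \<forall>w \<in> relators H (a l) (b l) \<inter> ?same. ?good N l w"
      using same[of N] by (elim exE conjE)
    have "?good N l w" if "l \<in> U" "w \<in> relators H (a l) (b l)" for l w
      using M bspec[OF bspec[OF good \<open>l \<in> U\<close>]] that(2) by (rule any)
    with U show "\<exists>U. l0 \<in> interior U \<and> (\<forall>l\<in>U. \<forall>w \<in> relators H (a l) (b l). ?good N l w)"
      by (intro exI[of _ U] conjI ballI)
  qed (rule same)
qed

end
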